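(* Let $n=2$, $H=\mathrm{Diag}(-5,-1)$, $c=(1,1)^T$. For every positive integer $d$ there exists a convex function $f_0:\mathbb{R}\to\mathbb{R}$ that is twice continuously differentiable and strongly convex on $\{y\in\mathbb{R}: y>0\}$ such that the problem of minimizing $$\tfrac12 x^THx+c^Tx+f_0(y)$$ over $(x,y)\in\mathbb{R}^2\times\mathbb{R}$ subject to $x^Tx-y\le 0$ has $d$ pairwise distinct local non-global minimizers.
   Context: A local non-global minimizer of a constrained problem is a feasible point that is a local minimizer but not a global minimizer. *)

theory Defs
  imports "HOL-Analysis.Analysis"
begin

text \<open>Twice continuous differentiability, meant for open sets \<open>S\<close> (two-sided derivatives).\<close>
definition twice_cont_diff_on :: "real set \<Rightarrow> (real \<Rightarrow> real) \<Rightarrow> bool" where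
  "twice_cont_diff_on S f \<longleftrightarrow>
     (\<exists>f' f''. (\<forall>y\<in>S. (f has_real_derivative f' y) (at y)) \<and>
               (\<forall>y\<in>S. (f' has_real_derivative f'' y) (at y)) \<and>
               continuous_on S f'')"

definition strongly_convex_on :: "'a::real_normed_vector set \<Rightarrow> ('a \<Rightarrow> real) \<Rightarrow> bool" where
  "strongly_convex_on S f \<longleftrightarrow> convex S \<and>
     (\<exists>\<mu>>0. \<forall>x\<in>S. \<forall>y\<in>S. \<forall>u\<ge>0. \<forall>v\<ge>0. u + v = 1 \<longrightarrow>
        f (u *\<^sub>R x + v *\<^sub>R y) \<le> u * f x + v * f y - \<mu> / 2 * u * v * (norm (x - y))\<^sup>2)"

definition local_minimizer :: "('a::metric_space \<Rightarrow> real) \<Rightarrow> 'a set \<Rightarrow> 'a \<Rightarrow> bool" where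
  "local_minimizer F S z \<longleftrightarrow> z \<in> S \<and> (\<exists>\<epsilon>>0. \<forall>w\<in>S. dist w z < \<epsilon> \<longrightarrow> F z \<le> F w)"

definition global_minimizer :: "('a \<Rightarrow> real) \<Rightarrow> 'a set \<Rightarrow> 'a \<Rightarrow> bool" where
  "global_minimizer F S z \<longleftrightarrow> z \<in> S \<and> (\<forall>w\<in>S. F z \<le> F w)"

definition local_nonglobal_minimizer :: "('a::metric_space \<Rightarrow> real) \<Rightarrow> 'a set \<Rightarrow> 'a \<Rightarrow> bool" where
  "local_nonglobal_minimizer F S z \<longleftrightarrow> local_minimizer F S z \<and> \<not> global_minimizer F S z"

definition objective ::
    "real^'n^'n \<Rightarrow> real^'n \<Rightarrow> (real \<Rightarrow> real) \<Rightarrow> (real^'n) \<times> real \<Rightarrow> real" where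
  "objective H c f\<^sub>0 = (\<lambda>(x, y). 1 / 2 * (x \<bullet> (H *v x)) + c \<bullet> x + f\<^sub>0 y)"

definition feasible_set :: "((real^'n) \<times> real) set" where
  "feasible_set = {(x, y). x \<bullet> x - y \<le> 0}"

end

theory Submission
  imports Defs
begin

text \<open>On the sphere \<open>x \<bullet> x = y\<close> the stationary points with multiplier \<open>4 + h\<close>, \<open>0 \<le> h < 1\<close>, are
  \<open>x = (1 / (1 - h), - 1 / (3 + h))\<close>. Together with \<open>y = x \<bullet> x\<close> such a point is a local minimizer as
  soon as \<open>f\<^sub>0' y = 2 + h / 2\<close> and the graph of \<open>f\<^sub>0'\<close> crosses the curve \<open>h \<mapsto> (x \<bullet> x, 2 + h / 2)\<close> from
  below; it is never a global one, because reflecting the first coordinate lowers the objective.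
  This curve is increasing with slope \<open>27 / 104\<close> at \<open>h = 0\<close>, so taking for \<open>f\<^sub>0'\<close> its tangent line there
  plus a sine of amplitude proportional to \<open>1 / N\<close> and frequency \<open>N\<close> gives an increasing function. The
  curve leaves its tangent only quadratically, so that the sine produces on the order of \<open>sqrt N\<close>
  crossings.\<close>

section \<open>Second-order conditions\<close>

text \<open>Near \<open>y0\<close> the second derivative exceeds \<open>K\<close>, so subtracting
  \<open>K / 2 * (y - y0)\<^sup>2\<close> leaves a convex function, which lies above its tangent at
  \<open>y0\<close>.\<close>

lemma second_derivative_lower_bound:
  fixes f f' f'' :: "real \<Rightarrow> real"
  assumes f: "\<And>y. (f has_real_derivative f' y) (at y)"
    and f': "\<And>y. (f' has_real_derivative f'' y) (at y)"
    and cont: "isCont f'' y0" and K: "K < f'' y0"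
  shows "\<forall>\<^sub>F y in nhds y0. f y0 + f' y0 * (y - y0) + K / 2 * (y - y0)\<^sup>2 \<le> f y"
proof -
  have "\<forall>\<^sub>F y in nhds y0. K < f'' y"
    using cont K by (metis isCont_def order_tendstoD(1) tendsto_at_iff_tendsto_nhds)
  then obtain e where e: "e > 0" "\<And>y. dist y y0 < e \<Longrightarrow> K < f'' y"
    unfolding eventually_nhds_metric by blast
  have "f y0 + f' y0 * (y - y0) + K / 2 * (y - y0)\<^sup>2 \<le> f y" if y: "dist y y0 < e" for y
  proof -
    let ?g = "\<lambda>y. f y - K / 2 * (y - y0)\<^sup>2" and ?g' = "\<lambda>y. f' y - K * (y - y0)"
    have "convex_on (ball y0 e) ?g"
    proof (rule f''_ge0_imp_convex)
      show "(?g has_real_derivative ?g' x) (at x)" for x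
        by (auto intro!: derivative_eq_intros f)
      show "(?g' has_real_derivative f'' x - K) (at x)" for x
        by (auto intro!: derivative_eq_intros f')
      show "f'' x - K \<ge> 0" if "x \<in> ball y0 e" for x
        using e(2)[of x] that by (simp add: dist_commute)
    qed simp
    moreover have "(?g has_real_derivative ?g' y0) (at y0 within ball y0 e)"
      by (rule has_field_derivative_at_within) (auto intro!: derivative_eq_intros f)
    ultimately have "?g y - ?g y0 \<ge> ?g' y0 * (y - y0)"
      using convex_on_imp_above_tangent[of "ball y0 e" ?g y0 y "?g' y0"] y e(1)
      by (auto simp: dist_commute)
    then show ?thesis by simp
  qed
  then show ?thesis
    unfolding eventually_nhds_metric using e(1) by blast
qed

text \<open>The form has matrix \<open>diag(-a, b) + 4 * K * w * w^T\<close>. Assumption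
  \<open>det\<close> says that its determinant is positive; this forces the upper left entry
  \<open>A\<close> to be positive too, and completing the square finishes.\<close>

lemma rank_one_perturbation_nonneg:
  fixes a b K w1 w2 u1 u2 :: real
  assumes "a > 0" "b > 0" "K > 0" and det: "a * b < 4 * K * (b * w1\<^sup>2 - a * w2\<^sup>2)"
  shows "0 \<le> - a * u1\<^sup>2 + b * u2\<^sup>2 + 4 * K * (w1 * u1 + w2 * u2)\<^sup>2" (is "0 \<le> ?q")
proof -
  define A where "A = 4 * K * w1\<^sup>2 - a"
  have "0 \<le> 4 * K * a * w2\<^sup>2" using assms by simp
  also have "\<dots> < b * A" using det by (simp add: A_def algebra_simps)
  finally have A: "A > 0" using \<open>b > 0\<close> by (simp add: zero_less_mult_iff)
  have "A * ?q = (A * u1 + 4 * K * w1 * w2 * u2)\<^sup>2 + (4 * K * (b * w1\<^sup>2 - a * w2\<^sup>2) - a * b) * u2\<^sup>2"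
    unfolding A_def by algebra
  also have "\<dots> \<ge> 0" using det by simp
  finally show ?thesis using A by (simp add: zero_le_mult_iff)
qed

section \<open>The problem in coordinates and its branch of stationary points\<close>

abbreviation H0 :: "real^2^2" where "H0 \<equiv> vector [vector [-5, 0], vector [0, -1]]"
abbreviation c0 :: "real^2" where "c0 \<equiv> vector [1, 1]"

lemma objective_coords:
  "objective H0 c0 f (v, y) = - 5 / 2 * (v $ 1)\<^sup>2 - 1 / 2 * (v $ 2)\<^sup>2 + v $ 1 + v $ 2 + f y"
  by (simp add: objective_def inner_vec_def matrix_vector_mult_def sum_2 power2_eq_square field_simps)

lemma feasible_coords: "(v :: real^2, y) \<in> feasible_set \<longleftrightarrow> (v $ 1)\<^sup>2 + (v $ 2)\<^sup>2 \<le> y"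
  by (simp add: feasible_set_def inner_vec_def sum_2 power2_eq_square)

text \<open>The solution of \<open>H0 *v x + c0 + (4 + h) *\<^sub>R x = 0\<close>. Since the
  gradient of \<open>x \<bullet> x\<close> is \<open>2 x\<close>, the multiplier of the constraint
  itself is \<open>2 + h / 2\<close>, which is the value that \<open>f'\<close> has to take.\<close>

definition branch :: "real \<Rightarrow> real^2" where
  "branch h = vector [1 / (1 - h), - (1 / (3 + h))]"

definition branch_radius :: "real \<Rightarrow> real" where
  "branch_radius h = 1 / (1 - h)\<^sup>2 + 1 / (3 + h)\<^sup>2"

lemma branch_nth [simp]: "branch h $ 1 = 1 / (1 - h)" "branch h $ 2 = - (1 / (3 + h))"
  by (simp_all add: branch_def)

text \<open>The slope of the curve \<open>(branch_radius h, 2 + h / 2)\<close> is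
  \<open>(a * b)^3 / (4 * (b^3 - a^3))\<close> with \<open>a = 1 - h\<close> and
  \<open>b = 3 + h\<close>. It is largest at \<open>h = 0\<close>, where it equals
  \<open>27 / 104\<close>, so \<open>curv\<close> is a second-order condition that serves all
  \<open>h\<close> at once.\<close>

lemma branch_local_minimizer:
  fixes f f' f'' :: "real \<Rightarrow> real"
  assumes f: "\<And>y. (f has_real_derivative f' y) (at y)"
    and f': "\<And>y. (f' has_real_derivative f'' y) (at y)"
    and cont: "isCont f'' (branch_radius h)" and h: "0 \<le> h" "h < 1"
    and stat: "f' (branch_radius h) = 2 + h / 2"
    and curv: "27 / 104 < f'' (branch_radius h)"
  shows "local_minimizer (objective H0 c0 f) feasible_set (branch h, branch_radius h)"
proof -
  \<comment> \<open>\<open>p\<close> is the multiplier, and \<open>diag(-a, b)\<close> is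
    \<open>H0\<close> plus \<open>2 * p\<close> times the identity.\<close>
  define a b p y0 where "a = 1 - h" "b = 3 + h" "p = 2 + h / 2" "y0 = branch_radius h"
  note defs = this
  have pos: "a > 0" "b > 0" "p > 0" using h by (auto simp: defs)
  obtain K where K: "27 / 104 < K" "K < f'' y0" using dense[OF curv] by (auto simp: defs)
  have mid: "(branch h $ 1 + 1 / a) / 2 = 1 / a" "(branch h $ 2 - 1 / b) / 2 = - (1 / b)"
    using pos by (simp_all add: defs field_simps)
  have "a * b \<le> 3" using h by (simp add: defs algebra_simps)
  then have "(a * b) ^ 3 \<le> 3 ^ 3" using pos by (intro power_mono) auto
  also have "\<dots> < 4 * K * 26" using K by simp
  also have "\<dots> \<le> 4 * K * (b ^ 3 - a ^ 3)"
  proof -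
    have "b ^ 3 \<ge> 3 ^ 3" "a ^ 3 \<le> 1 ^ 3" using h pos by (intro power_mono; simp add: defs)+
    then show ?thesis using K by (intro mult_left_mono) auto
  qed
  finally have det: "a * b < 4 * K * (b * (1 / a)\<^sup>2 - a * (- (1 / b))\<^sup>2)"
    using pos by (simp add: field_simps power2_eq_square power3_eq_cube)
  \<comment> \<open>The strict inequality \<open>det\<close> concerns the branch point; by
    continuity it persists when that point is replaced by its midpoint with a nearby
    \<open>fst z\<close>.\<close>
  have "((\<lambda>z. 4 * K * (b * ((fst z $ 1 + 1 / a) / 2)\<^sup>2 - a * ((fst z $ 2 - 1 / b) / 2)\<^sup>2))
      \<longlongrightarrow> 4 * K * (b * ((fst (branch h, y0) $ 1 + 1 / a) / 2)\<^sup>2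
        - a * ((fst (branch h, y0) $ 2 - 1 / b) / 2)\<^sup>2)) (nhds (branch h, y0))"
    by (intro tendsto_intros filterlim_ident) auto
  from order_tendstoD(1)[OF this[unfolded fst_conv mid] det]
  have ev_det: "\<forall>\<^sub>F z in nhds (branch h, y0). a * b
      < 4 * K * (b * ((fst z $ 1 + 1 / a) / 2)\<^sup>2 - a * ((fst z $ 2 - 1 / b) / 2)\<^sup>2)" .
  have "((\<lambda>z. p + K * ((fst z $ 1)\<^sup>2 + (fst z $ 2)\<^sup>2 - y0))
      \<longlongrightarrow> p + K * ((fst (branch h, y0) $ 1)\<^sup>2 + (fst (branch h, y0) $ 2)\<^sup>2 - y0))
      (nhds (branch h, y0))"
    by (intro tendsto_intros filterlim_ident)
  then have ev_mono: "\<forall>\<^sub>F z in nhds (branch h, y0). 0 < p + K * ((fst z $ 1)\<^sup>2 + (fst z $ 2)\<^sup>2 - y0)"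
    by (rule order_tendstoD(1)) (use pos in \<open>simp add: defs branch_radius_def power_divide\<close>)
  have "filterlim snd (nhds y0) (nhds (branch h, y0))"
    using tendsto_snd[OF filterlim_ident[of "nhds (branch h, y0)"]] by simp
  then have ev_f: "\<forall>\<^sub>F z in nhds (branch h, y0).
      f y0 + p * (snd z - y0) + K / 2 * (snd z - y0)\<^sup>2 \<le> f (snd z)"
    by (rule eventually_compose_filterlim[rotated])
      (use second_derivative_lower_bound[OF f f', of y0 K] cont K(2) stat in \<open>simp add: defs\<close>)
  have "\<forall>\<^sub>F z in nhds (branch h, y0).
      z \<in> feasible_set \<longrightarrow> objective H0 c0 f (branch h, y0) \<le> objective H0 c0 f z"
    using ev_det ev_mono ev_f
  proof eventually_elim
    case (elim z)
    show ?case
    proof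
      assume feas: "z \<in> feasible_set"
      obtain v y where z: "z = (v, y)" by (cases z)
      \<comment> \<open>\<open>u\<close> is the displacement from the branch point and
        \<open>w\<close> the midpoint, so the change \<open>r\<close> of the squared norm is exactly
        \<open>2 * (w \<bullet> u)\<close>, without an error term. \<open>s\<close> is the slack in
        the constraint.\<close>
      define u1 u2 w1 w2 r s where "u1 = v $ 1 - 1 / a" "u2 = v $ 2 + 1 / b"
        "w1 = (v $ 1 + 1 / a) / 2" "w2 = (v $ 2 - 1 / b) / 2"
        "r = 2 * (w1 * u1 + w2 * u2)" "s = y - y0 - r"
      note coords = this
      have y0: "y0 = (1 / a)\<^sup>2 + (1 / b)\<^sup>2" by (simp add: defs branch_radius_def power_divide)
      have r: "r = (v $ 1)\<^sup>2 + (v $ 2)\<^sup>2 - y0"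
        unfolding coords y0 by (simp add: power2_eq_square algebra_simps diff_divide_distrib)
      have "s \<ge> 0" using feas by (simp add: z feasible_coords coords(6) r)
      have "0 \<le> - a * u1\<^sup>2 + b * u2\<^sup>2 + 4 * K * (w1 * u1 + w2 * u2)\<^sup>2"
        using elim(1) pos K by (intro rank_one_perturbation_nonneg) (auto simp: coords z)
      also have "4 * K * (w1 * u1 + w2 * u2)\<^sup>2 = K * r\<^sup>2"
        unfolding coords(5) by algebra
      finally have form: "0 \<le> - a * u1\<^sup>2 + b * u2\<^sup>2 + K * r\<^sup>2" .
      \<comment> \<open>Positive slack does not help: near the branch point the quadratic lower
        bound for \<open>f\<close> is smallest on the boundary \<open>s = 0\<close>.\<close>
      have "0 \<le> s * (p + K * r) + K / 2 * s\<^sup>2"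
        using elim(2) \<open>s \<ge> 0\<close> K by (simp add: z r)
      also have "\<dots> = p * (r + s) + K / 2 * (r + s)\<^sup>2 - p * r - K / 2 * r\<^sup>2"
        by (simp add: power2_eq_square algebra_simps)
      also have "\<dots> \<le> f y - f y0 - p * r - K / 2 * r\<^sup>2"
        using elim(3) by (simp add: z coords(6))
      finally have step: "p * r + (K * r\<^sup>2) / 2 \<le> f y - f y0" by simp
      \<comment> \<open>An exact expansion of the quadratic part plus \<open>p * r\<close>: the
        terms linear in \<open>u\<close> cancel by stationarity.\<close>
      have "- 5 / 2 * (v $ 1)\<^sup>2 - 1 / 2 * (v $ 2)\<^sup>2 + v $ 1 + v $ 2 + p * r
          = - 5 / 2 * (1 / a)\<^sup>2 - 1 / 2 * (1 / b)\<^sup>2 + 1 / a - 1 / b + (- a * u1\<^sup>2 + b * u2\<^sup>2) / 2"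
      proof -
        have v: "v $ 1 = u1 + 1 / a" "v $ 2 = u2 - 1 / b" by (simp_all add: coords)
        have inv: "a * (1 / a) = 1" "b * (1 / b) = 1" using pos by auto
        have "2 * p = 5 - a" "2 * p = b + 1" by (auto simp: defs)
        then show ?thesis unfolding r y0 v using inv by algebra
      qed
      moreover have "(- a * u1\<^sup>2 + b * u2\<^sup>2) / 2 + (K * r\<^sup>2) / 2 \<ge> 0"
        using form by (simp flip: add_divide_distrib)
      moreover have br: "branch h $ 1 = 1 / a" "branch h $ 2 = - (1 / b)" by (simp_all add: defs)
      ultimately show "objective H0 c0 f (branch h, y0) \<le> objective H0 c0 f z"
        using step unfolding z objective_coords br power2_minus by linarith
    qed
  qed
  moreover have "(branch h, y0) \<in> feasible_set"
    by (simp add: feasible_coords defs branch_radius_def power_divide)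
  ultimately show ?thesis
    unfolding local_minimizer_def eventually_nhds_metric defs by blast
qed

lemma branch_not_global_minimizer:
  assumes "h < 1"
  shows "\<not> global_minimizer (objective H0 c0 f) feasible_set (branch h, branch_radius h)"
proof -
  define v :: "real^2" where "v = vector [- (1 / (1 - h)), - (1 / (3 + h))]"
  have "objective H0 c0 f (v, branch_radius h) < objective H0 c0 f (branch h, branch_radius h)"
    using assms by (simp add: objective_coords v_def)
  moreover have "(v, branch_radius h) \<in> feasible_set"
    by (simp add: feasible_coords v_def branch_radius_def power_divide)
  ultimately show ?thesis unfolding global_minimizer_def by force
qed

section \<open>The crossings\<close>

text \<open>\<open>10 / 9 + 52 / 27 * h\<close> is the tangent of \<open>branch_radius\<close> at
  \<open>0\<close>. The remainders of its two summands are \<open>h\<^sup>2 * A\<close> and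
  \<open>h\<^sup>2 * B\<close>, with \<open>A\<close> at most \<open>12\<close> and \<open>B\<close>
  below \<open>1\<close>.\<close>

lemma branch_radius_expansion:
  assumes "0 \<le> h" "h \<le> 1 / 2"
  shows "0 \<le> branch_radius h - 10 / 9 - 52 / 27 * h"
    and "branch_radius h - 10 / 9 - 52 / 27 * h \<le> 13 * h\<^sup>2"
proof -
  define A B where "A = (3 - 2 * h) / (1 - h)\<^sup>2" "B = (9 + 2 * h) / (27 * (3 + h)\<^sup>2)"
  note AB = this
  have e: "branch_radius h - 10 / 9 - 52 / 27 * h = h\<^sup>2 * (A + B)"
    using assms unfolding branch_radius_def AB by (simp add: divide_simps) algebra
  have "0 \<le> A" "0 \<le> B" using assms by (auto simp: AB)
  then show "0 \<le> branch_radius h - 10 / 9 - 52 / 27 * h" unfolding e by simp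
  have "A \<le> 3 / (1 / 2)\<^sup>2" unfolding AB using assms by (intro frac_le power_mono) auto
  moreover have "B \<le> 10 / (27 * 3\<^sup>2)"
    unfolding AB using assms by (intro frac_le mult_left_mono power_mono) auto
  ultimately have "A + B \<le> 13" by (simp add: power2_eq_square)
  then show "branch_radius h - 10 / 9 - 52 / 27 * h \<le> 13 * h\<^sup>2"
    unfolding e by (metis mult.commute mult_right_mono zero_le_power2)
qed

lemma continuous_on_branch_radius: "continuous_on {0..1 / 2} branch_radius"
  unfolding branch_radius_def by (intro continuous_intros) auto

lemma branch_radius_strict_mono:
  assumes "0 \<le> x" "x < y" "y \<le> 1 / 2"
  shows "branch_radius x < branch_radius y"
proof (rule DERIV_pos_imp_increasing[OF \<open>x < y\<close>])
  fix h assume "x \<le> h" "h \<le> y"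
  then have h: "0 \<le> h" "h \<le> 1 / 2" using assms by auto
  have "(branch_radius has_real_derivative 2 / (1 - h) ^ 3 - 2 / (3 + h) ^ 3) (at h)"
    unfolding branch_radius_def using h
    by (auto intro!: derivative_eq_intros)
      (simp add: divide_simps, algebra)
  moreover have "(1 - h) ^ 3 < (3 + h) ^ 3" using h by (intro power_strict_mono) auto
  then have "2 / (1 - h) ^ 3 > 2 / (3 + h) ^ 3" using h by (intro divide_strict_left_mono) auto
  ultimately show "\<exists>d. (branch_radius has_real_derivative d) (at h) \<and> 0 < d" by auto
qed

text \<open>Across the window the sine climbs from \<open>- 1\<close> to \<open>1\<close>, while the
  curve leaves its tangent by \<open>O(h\<^sup>2)\<close> with \<open>h = O(k / N)\<close>. For
  \<open>N\<close> of order \<open>k\<^sup>2\<close> this is below the amplitude, so the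
  intermediate value theorem applies.\<close>

lemma crossing_exists:
  fixes N :: real and k :: nat
  assumes k: "k > 0" and N: "N \<ge> 1000 * (real k + 1)\<^sup>2"
  obtains h where "0 \<le> h" "h \<le> 1 / 2"
    "N * (branch_radius h - 10 / 9) \<in> {2 * pi * k - pi / 2<..<2 * pi * k + pi / 2}"
    "27 / 104 * (branch_radius h - 10 / 9) + 27 / (208 * N) * sin (N * (branch_radius h - 10 / 9)) = h / 2"
proof -
  define s where "s = (\<lambda>h. branch_radius h - 10 / 9)"
  \<comment> \<open>The required equation, multiplied by \<open>104 / 27\<close>, reads
    \<open>G h = 0\<close>.\<close>
  define G where "G = (\<lambda>h. s h - 52 / 27 * h + sin (N * s h) / (2 * N))"
  have pi: "3 < pi" "pi < 16 / 5" using pi_gt3 pi_approx by auto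
  have k1: "real k \<ge> 1" using k by simp
  have "(real k + 1)\<^sup>2 \<ge> (1 + 1)\<^sup>2" using k1 by (intro power_mono) auto
  then have N0: "N > 0" using N by simp
  have cs: "continuous_on {0..1 / 2} s"
    unfolding s_def by (intro continuous_intros continuous_on_branch_radius)
  have cG: "continuous_on {0..1 / 2} G"
    unfolding G_def using N0 by (intro continuous_intros cs) auto
  have s0: "s 0 = 0" and s1: "s (1 / 2) \<ge> 2"
    by (simp_all add: s_def branch_radius_def power2_eq_square)
  have bound: "0 \<le> 2 * pi * k + t" "2 * pi * k + t \<le> 8 * (real k + 1)"
    if t: "t \<in> {- pi / 2..pi / 2}" for t
  proof -
    have "2 * pi * k \<ge> 2 * pi" using k1 by simp
    moreover have "t \<ge> - pi / 2" using t by simp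
    ultimately show "0 \<le> 2 * pi * k + t" using pi by linarith
    have "pi * (2 * real k + 1) \<le> 4 * (2 * real k + 1)" using pi by (intro mult_right_mono) auto
    then show "2 * pi * k + t \<le> 8 * (real k + 1)" using t pi by (auto simp: algebra_simps)
  qed
  have level: "\<exists>h\<in>{0..1 / 2}. s h = (2 * pi * k + t) / N" if t: "t \<in> {- pi / 2..pi / 2}" for t
  proof -
    have "8 * (real k + 1) \<le> 8 * (real k + 1)\<^sup>2" using k1
      by (intro mult_left_mono self_le_power) auto
    then have "0 \<le> (2 * pi * k + t) / N" "(2 * pi * k + t) / N \<le> 2"
      using N N0 bound[OF t] by (auto simp: divide_simps)
    then show ?thesis
      using IVT'[of s 0 "(2 * pi * k + t) / N" "1 / 2"] s0 s1 cs by force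
  qed
  obtain h1 where h1: "h1 \<in> {0..1 / 2}" "s h1 = (2 * pi * k + (- pi / 2)) / N"
    using level[of "- pi / 2"] by auto
  obtain h2 where h2: "h2 \<in> {0..1 / 2}" "s h2 = (2 * pi * k + pi / 2) / N"
    using level[of "pi / 2"] by auto
  have "s h1 < s h2" unfolding h1 h2 using N0 by (intro divide_strict_right_mono) auto
  then have "h1 < h2"
    using branch_radius_strict_mono[of h2 h1] h1(1) h2(1)
    by (cases h1 h2 rule: linorder_cases) (auto simp: s_def)
  have per: "sin (2 * pi * k + t) = sin t" for t
    using sin_int_2pin[of "int k"] cos_int_2pin[of "int k"] by (simp add: sin_add)
  have "G h1 < 0"
  proof -
    have "0 \<le> s h1 - 52 / 27 * h1" "s h1 - 52 / 27 * h1 \<le> 13 * h1\<^sup>2"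
      using branch_radius_expansion[of h1] h1(1) by (auto simp: s_def)
    \<comment> \<open>The left end is the critical one, because there the deviation from the tangent
      works against the sine. The factor \<open>1000\<close> in the bound on \<open>N\<close> keeps
      \<open>13 * h1\<^sup>2\<close> below \<open>1 / (2 * N)\<close>.\<close>
    moreover have "s h1 \<le> 8 * (real k + 1) / N"
      using bound(2)[of "- pi / 2"] N0 unfolding h1 by (intro divide_right_mono) auto
    ultimately have "h1 \<le> 27 / 52 * (8 * (real k + 1) / N)" by linarith
    then have "h1\<^sup>2 \<le> (27 / 52 * (8 * (real k + 1) / N))\<^sup>2"
      using h1(1) by (intro power_mono) auto
    also have "\<dots> = (27 / 52 * 8)\<^sup>2 / (1000 * N) * (1000 * (real k + 1)\<^sup>2 / N)"
      using N0 by (simp add: power2_eq_square field_simps)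
    also have "\<dots> \<le> (27 / 52 * 8)\<^sup>2 / (1000 * N) * 1"
      using N N0 by (intro mult_left_mono) auto
    finally have "13 * h1\<^sup>2 \<le> 13 * ((27 / 52 * 8)\<^sup>2 / (1000 * N))" by simp
    also have "\<dots> < 1 / (2 * N)" using N0 by (simp add: power2_eq_square field_simps)
    finally have "13 * h1\<^sup>2 < 1 / (2 * N)" by simp
    moreover have "sin (N * s h1) = - 1" using per[of "- pi / 2"] N0 by (simp add: h1)
    ultimately show ?thesis
      using \<open>s h1 - 52 / 27 * h1 \<le> 13 * h1\<^sup>2\<close> by (simp add: G_def)
  qed
  moreover have "G h2 > 0"
  proof -
    have "0 \<le> s h2 - 52 / 27 * h2"
      using branch_radius_expansion[of h2] h2(1) by (auto simp: s_def)
    moreover have "sin (N * s h2) = 1" using per[of "pi / 2"] N0 by (simp add: h2)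
    ultimately show ?thesis using N0 by (simp add: G_def add_nonneg_pos)
  qed
  moreover have "continuous_on {h1..h2} G"
    using h1(1) h2(1) by (intro continuous_on_subset[OF cG]) auto
  ultimately obtain h where h: "h1 \<le> h" "h \<le> h2" "G h = 0"
    using IVT'[of G h1 0 h2] \<open>h1 < h2\<close> by force
  \<comment> \<open>Strictness matters: on the open window the cosine is positive, which gives the
    crossing from below.\<close>
  then have "h1 < h" "h < h2" using \<open>G h1 < 0\<close> \<open>G h2 > 0\<close> by (auto simp: le_less)
  then have "s h1 < s h" "s h < s h2"
    using branch_radius_strict_mono[of h1 h] branch_radius_strict_mono[of h h2] h1(1) h2(1)
    by (auto simp: s_def)
  then have "N * s h \<in> {2 * pi * k - pi / 2<..<2 * pi * k + pi / 2}"
    using N0 unfolding h1 h2 by (auto simp: field_simps)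
  moreover have "27 / 104 * s h + 27 / (208 * N) * sin (N * s h) = h / 2"
    using h(3) N0 by (simp add: G_def field_simps)
  ultimately show ?thesis
    using that[of h] h h1(1) h2(1) by (auto simp: s_def)
qed

section \<open>Strong convexity and assembly of the example\<close>

lemma convex_and_strongly_convex:
  fixes f f' f'' :: "real \<Rightarrow> real"
  assumes f: "\<And>y. (f has_real_derivative f' y) (at y)"
    and f': "\<And>y. (f' has_real_derivative f'' y) (at y)"
    and m: "m > 0" "\<And>y. m \<le> f'' y"
  shows "convex_on UNIV f" and "convex S \<Longrightarrow> strongly_convex_on S f"
proof -
  show "convex_on UNIV f"
    using f''_ge0_imp_convex[of UNIV f f' f''] f f' m by (simp add: order.trans[OF less_imp_le])
  let ?g = "\<lambda>y. f y - m / 2 * y\<^sup>2" and ?g' = "\<lambda>y. f' y - m * y"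
  have g: "convex_on UNIV ?g"
  proof (rule f''_ge0_imp_convex)
    show "(?g has_real_derivative ?g' x) (at x)" for x
      by (auto intro!: derivative_eq_intros f)
    show "(?g' has_real_derivative f'' x - m) (at x)" for x
      by (auto intro!: derivative_eq_intros f')
  qed (use m in auto)
  show "strongly_convex_on S f" if "convex S"
    unfolding strongly_convex_on_def
  proof (intro conjI that exI[of _ m] m(1) ballI allI impI)
    fix x y u v :: real
    assume uv: "u \<ge> 0" "v \<ge> 0" "u + v = 1"
    have "?g (u *\<^sub>R x + v *\<^sub>R y) \<le> u * ?g x + v * ?g y"
      using g uv unfolding convex_on_def by blast
    moreover have "u * x\<^sup>2 + v * y\<^sup>2 - (u * x + v * y)\<^sup>2 = u * v * (x - y)\<^sup>2"
      using uv(3) by algebra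
    then have "m / 2 * (u * x + v * y)\<^sup>2 = m / 2 * (u * x\<^sup>2 + v * y\<^sup>2) - m / 2 * (u * v * (x - y)\<^sup>2)"
      by algebra
    ultimately show "f (u *\<^sub>R x + v *\<^sub>R y) \<le> u * f x + v * f y - m / 2 * u * v * (norm (x - y))\<^sup>2"
      by (simp add: algebra_simps)
  qed
qed

theorem mainTheorem7:
  fixes H :: "real^2^2" and c :: "real^2" and d :: nat
  assumes "H = vector [vector [-5, 0], vector [0, -1]]"
    and "c = vector [1, 1]"
    and "d > 0"
  shows "\<exists>f\<^sub>0 :: real \<Rightarrow> real.
           convex_on UNIV f\<^sub>0 \<and>
           twice_cont_diff_on {0<..} f\<^sub>0 \<and>
           strongly_convex_on {0<..} f\<^sub>0 \<and>
           (\<exists>M. finite M \<and> card M = d \<and>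
                (\<forall>z\<in>M. local_nonglobal_minimizer (objective H c f\<^sub>0) feasible_set z))"
proof -
  \<comment> \<open>One \<open>N\<close> that is large enough for every \<open>k\<close> up to
    \<open>d\<close>.\<close>
  define N where "N = 1000 * (real d + 1)\<^sup>2"
  have N0: "N > 0" by (simp add: N_def)
  \<comment> \<open>\<open>f'\<close> is the tangent line plus the sine. The amplitude makes the
    cosine coefficient in \<open>f''\<close> half of \<open>27 / 104\<close>, so \<open>f''\<close>
    stays at least \<open>27 / 208\<close>.\<close>
  define f f' f'' where
    "f = (\<lambda>y. 2 * y + 27 / 208 * (y - 10 / 9)\<^sup>2 - 27 / (208 * N\<^sup>2) * cos (N * (y - 10 / 9)))"
    "f' = (\<lambda>y. 2 + (27 / 104 * (y - 10 / 9) + 27 / (208 * N) * sin (N * (y - 10 / 9))))"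
    "f'' = (\<lambda>y. 27 / 104 + 27 / 208 * cos (N * (y - 10 / 9)))"
  have f: "(f has_real_derivative f' y) (at y)" for y
    unfolding f_f'_f''_def using N0
    by (auto intro!: derivative_eq_intros simp: power2_eq_square field_simps)
  have f': "(f' has_real_derivative f'' y) (at y)" for y
    unfolding f_f'_f''_def using N0
    by (auto intro!: derivative_eq_intros simp: field_simps)
  have cont: "isCont f'' y" for y
    unfolding f_f'_f''_def by (intro continuous_intros)
  have lower: "27 / 208 \<le> f'' y" for y
  proof -
    have "27 / 208 * cos (N * (y - 10 / 9)) \<ge> 27 / 208 * (- 1)"
      by (intro mult_left_mono cos_ge_minus_one) simp
    then show ?thesis unfolding f_f'_f''_def by linarith
  qed
  let ?window = "\<lambda>k :: nat. {2 * pi * k - pi / 2<..<2 * pi * k + pi / 2}"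
  have "\<exists>h. 0 \<le> h \<and> h \<le> 1 / 2 \<and> N * (branch_radius h - 10 / 9) \<in> ?window k
      \<and> f' (branch_radius h) = 2 + h / 2" if "k \<in> {1..d}" for k
  proof -
    have "(real k + 1)\<^sup>2 \<le> (real d + 1)\<^sup>2" using that by (intro power_mono) auto
    then show ?thesis
      using crossing_exists[of k N] that by (force simp: N_def f_f'_f''_def)
  qed
  then obtain h where h: "\<forall>k\<in>{1..d}. 0 \<le> h k \<and> h k \<le> 1 / 2
      \<and> N * (branch_radius (h k) - 10 / 9) \<in> ?window k \<and> f' (branch_radius (h k)) = 2 + h k / 2"
    using bchoice[of "{1..d}" "\<lambda>k h. 0 \<le> h \<and> h \<le> 1 / 2
      \<and> N * (branch_radius h - 10 / 9) \<in> ?window k \<and> f' (branch_radius h) = 2 + h / 2"] by blast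
  note h = bspec[OF h]
  let ?z = "\<lambda>k. (branch (h k), branch_radius (h k))"
  have "local_nonglobal_minimizer (objective H c f) feasible_set (?z k)" if k: "k \<in> {1..d}" for k
  proof -
    let ?t = "N * (branch_radius (h k) - 10 / 9)"
    have "cos ?t = cos (?t - 2 * pi * k)"
      using sin_int_2pin[of "int k"] cos_int_2pin[of "int k"] by (simp add: cos_diff)
    also have "\<dots> > 0"
    proof (rule cos_gt_zero_pi)
      have "2 * pi * k - pi / 2 < ?t" "?t < 2 * pi * k + pi / 2" using h[OF k] by auto
      then show "- (pi / 2) < ?t - 2 * pi * k" "?t - 2 * pi * k < pi / 2" by linarith+
    qed
    finally have "27 / 104 < f'' (branch_radius (h k))" by (simp add: f_f'_f''_def)
    then show ?thesis
      unfolding local_nonglobal_minimizer_def assms(1,2)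
      using branch_local_minimizer[OF f f' cont] branch_not_global_minimizer h[OF k] by auto
  qed
  \<comment> \<open>The windows have length \<open>pi\<close> and centers \<open>2 * pi\<close>
    apart, so they are disjoint and the radius determines \<open>k\<close>.\<close>
  moreover have "inj_on ?z {1..d}"
  proof (rule inj_onI)
    fix j k assume jk: "j \<in> {1..d}" "k \<in> {1..d}" "?z j = ?z k"
    then have "\<bar>2 * pi * j - 2 * pi * k\<bar> < pi"
    proof -
      let ?t = "\<lambda>k. N * (branch_radius (h k) - 10 / 9)"
      have "?t j = ?t k" using jk(3) by simp
      moreover have "2 * pi * j - pi / 2 < ?t j" "?t j < 2 * pi * j + pi / 2"
        using h[OF jk(1)] by auto
      moreover have "2 * pi * k - pi / 2 < ?t k" "?t k < 2 * pi * k + pi / 2"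
        using h[OF jk(2)] by auto
      ultimately show ?thesis by linarith
    qed
    also have "\<bar>2 * pi * j - 2 * pi * k\<bar> = pi * \<bar>2 * (real j - real k)\<bar>"
    proof -
      have "2 * pi * j - 2 * pi * k = pi * (2 * (real j - real k))" by (simp add: algebra_simps)
      then show ?thesis by (simp only: abs_mult abs_of_pos[OF pi_gt_zero])
    qed
    finally have "\<bar>2 * (real j - real k)\<bar> < 1" by simp
    then have "real j < real (k + 1)" "real k < real (j + 1)" by simp_all
    then show "j = k" unfolding of_nat_less_iff by simp
  qed
  then have "card (?z ` {1..d}) = d" by (simp add: card_image)
  moreover have "twice_cont_diff_on {0<..} f"
    unfolding twice_cont_diff_on_def using f f' cont by (blast intro: continuous_at_imp_continuous_on)
  moreover have "convex_on UNIV f" "strongly_convex_on {0<..} f"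
    using convex_and_strongly_convex[OF f f', of "27 / 208"] lower by auto
  ultimately show ?thesis
    by (intro exI[of _ f] conjI exI[of _ "?z ` {1..d}"]) auto
qed

end
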